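(* Let $S$ be a basic $\vee$-semilattice. Then for all $p,p',s,t\in S$, $$p'\prec p\leq s\vee t\quad\Rightarrow\quad\exists s'\leq s\ \exists t'\leq t\ (p'\prec s'\vee t'\leq p).$$
   Context: A $\vee$-semilattice is a non-empty poset in which any two elements $p,q$ have a supremum $p\vee q$. A non-empty finite $F\subseteq S$ is far if for all $p,q\in S$: if $p\leq q\vee f$ for all $f\in F$, then $p\leq q$. The rather below relation on $S$ is defined by: $p\prec q$ iff for all $s\in S$ with $s\nleq q$ there is a finite $F\subseteq S$ such that $F\cup\{p\}$ is far and $s\leq f\vee q$ for all $f\in F$. $S$ is basic if for all $p,q,s,t\in S$: $t\prec q\vee s$ and $t\prec p\vee s$ imply that there is $r\in S$ with $r\leq p$, $r\leq q$ and $t\prec r\vee s$. *)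

theory Defs
  imports Main
begin

context semilattice_sup
begin

definition far :: "'a set \<Rightarrow> bool" where
  "far F \<longleftrightarrow> finite F \<and> F \<noteq> {} \<and>
     (\<forall>p q. (\<forall>f\<in>F. p \<le> sup q f) \<longrightarrow> p \<le> q)"

text \<open>The witness \<open>F\<close> below may be empty; only \<open>F \<union> {p}\<close> has to be non-empty.\<close>

definition rather_below :: "'a \<Rightarrow> 'a \<Rightarrow> bool"  (infix "\<prec>" 50) where
  "p \<prec> q \<longleftrightarrow>
     (\<forall>s. \<not> s \<le> q \<longrightarrow>
        (\<exists>F. finite F \<and> far (F \<union> {p}) \<and> (\<forall>f\<in>F. s \<le> sup f q)))"

end

class basic_semilattice_sup = semilattice_sup +
  assumes basic:
    "t \<prec> sup q s \<Longrightarrow> t \<prec> sup p s \<Longrightarrow> \<exists>r. r \<le> p \<and> r \<le> q \<and> t \<prec> sup r s"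

end

theory Submission
  imports Defs
begin

text \<open>Basicness replaces two elements by a common lower bound while a third joinand stays
  fixed. Applied to \<open>s\<close> and \<open>p\<close> over \<open>t\<close>, it shrinks
  \<open>s\<close> to \<open>s'\<close> below \<open>p\<close>; applied to \<open>t\<close> and
  \<open>p\<close> over \<open>s'\<close>, it shrinks \<open>t\<close> to \<open>t'\<close> below
  \<open>p\<close>. Its premises come from \<open>rather_below_mono\<close>.\<close>

text \<open>The witness \<open>F\<close> for \<open>q\<close> serves \<open>r\<close> unchanged,
  since farness of \<open>F \<union> {p}\<close> does not involve the upper element.\<close>

lemma (in semilattice_sup) rather_below_mono:
  assumes "p \<prec> q" and "q \<le> r"
  shows "p \<prec> r"
  unfolding rather_below_def
proof (intro allI impI)
  fix s
  assume "\<not> s \<le> r"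
  then have "\<not> s \<le> q"
    using \<open>q \<le> r\<close> by (meson order_trans)
  then obtain F where "finite F" "far (F \<union> {p})" and F: "\<forall>f\<in>F. s \<le> sup f q"
    using \<open>p \<prec> q\<close> unfolding rather_below_def by blast
  moreover have "\<forall>f\<in>F. s \<le> sup f r"
    using F \<open>q \<le> r\<close> by (meson order_refl order_trans sup_mono)
  ultimately show "\<exists>F. finite F \<and> far (F \<union> {p}) \<and> (\<forall>f\<in>F. s \<le> sup f r)"
    by blast
qed

theorem proposition6p5:
  fixes p p' s t :: "'a::basic_semilattice_sup"
  assumes "p' \<prec> p" and "p \<le> sup s t"
  shows "\<exists>s'\<le>s. \<exists>t'\<le>t. p' \<prec> sup s' t' \<and> sup s' t' \<le> p"
proof -
  have "p' \<prec> sup s t" "p' \<prec> sup p t"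
    using assms rather_below_mono sup_ge1 by blast+
  then obtain s' where s': "s' \<le> s" "s' \<le> p" "p' \<prec> sup s' t"
    using basic by blast
  \<comment> \<open>The fixed joinand is now \<open>s'\<close> rather than \<open>s\<close>, so
    shrinking \<open>t\<close> keeps the bound \<open>s' \<le> p\<close> already gained.\<close>
  have "p' \<prec> sup t s'" "p' \<prec> sup p s'"
    using s'(3) assms(1) rather_below_mono sup_ge1 by (simp add: sup_commute, blast)
  then obtain t' where t': "t' \<le> t" "t' \<le> p" "p' \<prec> sup t' s'"
    using basic by blast
  have "p' \<prec> sup s' t'" "sup s' t' \<le> p"
    using s' t' by (simp_all add: sup_commute)
  with s'(1) t'(1) show ?thesis
    by blast
qed

end
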